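(* Fix an integer $d\ge 2$. Let $(A_n)_{n\ge1}$ be a sequence of finite nonempty sets $A_n\subset\mathbb{Z}^{m_n}$ with $|A_n|\to\infty$ and $\|A_n\|=|A_n|^{o(1)}$ as $n\to\infty$. Suppose that each $A_n$ contains a $d$-dimensional spherical Freiman model $D_n$, i.e. a nonempty subset $D_n\subseteq A_n$ that is Freiman isomorphic, of some order $h_n\ge 2$, to a subset of $\mathcal{F}_{d,R_n^2}$ for some positive integer $R_n$. Then $$|D_n|\le |A_n|^{1-2^{-(d-1)}+o(1)}\qquad (n\to\infty).$$
   Context: For a finite set $A\subset\mathbb{Z}^m$, the Fourier $L^1$ norm is $\|A\|:=\int_{\mathbb{T}^m}\big|\sum_{a\in A}e(a\cdot t)\big|\,dt$, where $e(x)=e^{2\pi i x}$ and $\mathbb{T}=\mathbb{R}/\mathbb{Z}$. For a positive integer $R$, $\mathcal{F}_{d,R^2}:=\{x\in\mathbb{Z}^d: |x|^2=R^2\}$ (Euclidean norm). A map $\phi:D\to D'$ between subsets of abelian groups is a Freiman $h$-homomorphism if $d_1+\cdots+d_h=d_{h+1}+\cdots+d_{2h}$ with all $d_i\in D$ implies $\phi(d_1)+\cdots+\phi(d_h)=\phi(d_{h+1})+\cdots+\phi(d_{2h})$. A Freiman $h$-isomorphism is a bijection for which this implication holds in both directions. *)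

theory Defs
  imports "HOL-Analysis.Analysis" "HOL-Library.Function_Algebras" "HOL-Library.Landau_Symbols"
begin

text \<open>
  Since the ambient dimension varies along a sequence, the group of integer vectors of length \<open>m\<close>
  is realised as the subgroup of \<open>nat \<Rightarrow> int\<close> (with pointwise addition, from
  \<^theory>\<open>HOL-Library.Function_Algebras\<close>) of functions vanishing from index \<open>m\<close> on.
\<close>

definition int_lattice :: "nat \<Rightarrow> (nat \<Rightarrow> int) set" where
  "int_lattice m = {x. \<forall>i\<ge>m. x i = 0}"

definition lattice_sphere :: "nat \<Rightarrow> nat \<Rightarrow> (nat \<Rightarrow> int) set" where
  "lattice_sphere d R = {x \<in> int_lattice d. (\<Sum>i<d. (x i)\<^sup>2) = (int R)\<^sup>2}"

definition e_char :: "real \<Rightarrow> complex" where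
  "e_char x = exp (2 * of_real pi * \<i> * of_real x)"

text \<open>
  Haar measure on the torus, as Lebesgue measure on the fundamental domain \<open>[0,1)\<close> in each of the
  \<open>m\<close> coordinates; the integrands below are 1-periodic in each coordinate.
\<close>

definition torus_measure :: "nat \<Rightarrow> (nat \<Rightarrow> real) measure" where
  "torus_measure m = PiM {..<m} (\<lambda>_. restrict_space lborel {0..<1})"

definition fourier_L1 :: "nat \<Rightarrow> (nat \<Rightarrow> int) set \<Rightarrow> real" where
  "fourier_L1 m A = (LINT t|torus_measure m. cmod (\<Sum>a\<in>A. e_char (\<Sum>i<m. of_int (a i) * t i)))"

definition freiman_hom ::
  "nat \<Rightarrow> ('a::ab_group_add \<Rightarrow> 'b::ab_group_add) \<Rightarrow> 'a set \<Rightarrow> 'b set \<Rightarrow> bool" where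
  "freiman_hom h \<phi> D D' \<longleftrightarrow> \<phi> ` D \<subseteq> D' \<and>
    (\<forall>x y. (\<forall>i<h. x i \<in> D \<and> y i \<in> D) \<longrightarrow>
       (\<Sum>i<h. x i) = (\<Sum>i<h. y i) \<longrightarrow> (\<Sum>i<h. \<phi> (x i)) = (\<Sum>i<h. \<phi> (y i)))"

definition freiman_iso ::
  "nat \<Rightarrow> ('a::ab_group_add \<Rightarrow> 'b::ab_group_add) \<Rightarrow> 'a set \<Rightarrow> 'b set \<Rightarrow> bool" where
  "freiman_iso h \<phi> D D' \<longleftrightarrow> bij_betw \<phi> D D' \<and> freiman_hom h \<phi> D D' \<and>
    (\<forall>x y. (\<forall>i<h. x i \<in> D \<and> y i \<in> D) \<longrightarrow>
       (\<Sum>i<h. \<phi> (x i)) = (\<Sum>i<h. \<phi> (y i)) \<longrightarrow> (\<Sum>i<h. x i) = (\<Sum>i<h. y i))"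

definition spherical_freiman_model :: "nat \<Rightarrow> (nat \<Rightarrow> int) set \<Rightarrow> bool" where
  "spherical_freiman_model d D \<longleftrightarrow> D \<noteq> {} \<and>
    (\<exists>h\<ge>2. \<exists>R>0. \<exists>S \<subseteq> lattice_sphere d R. \<exists>\<phi>. freiman_iso h \<phi> D S)"

end

theory Submission
  imports Defs
begin

text \<open>
  Let \<open>K = \<parallel>A\<parallel>\<close> and let \<open>E(B)\<close> be the additive energy of \<open>B \<subseteq> A\<close>. Writing \<open>F\<^sub>S\<close> for
  the exponential sum over \<open>S\<close>, we have
  \<open>|B| = \<integral> F\<^sub>A \<cdot> cnj F\<^sub>B\<close>, and two applications of the Cauchy--Schwarz inequality give
  \<open>|B|\<^sup>4 \<le> K\<^sup>2 |A| E(B)\<close>. If \<open>B\<close> is modelled on a \<open>k\<close>-dimensional slice of a sphere, then the points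
  \<open>x\<close> of the slice whose reflection \<open>z - x\<close> is again in the slice satisfy one more linear equation
  with normal \<open>z\<close>; so, unless \<open>z\<close> is twice the centre, the set \<open>B \<inter> (w - B)\<close> is modelled on a
  \<open>(k - 1)\<close>-dimensional slice. If sets of the latter kind have at most \<open>M\<close> elements, then
  \<open>E(B) \<le> |B|\<^sup>2 (M + 1)\<close>, hence \<open>|B|\<^sup>2 \<le> K\<^sup>2 |A| (M + 1)\<close>. Starting from \<open>|B| \<le> 2\<close> for \<open>k = 1\<close>,
  induction gives \<open>|B| \<le> 2 K\<^sup>2 |A| powr (1 - 1 / 2 ^ (k - 1))\<close>.
\<close>

section \<open>Characters of the torus\<close>

lemma int_lattice_add: "x \<in> int_lattice m \<Longrightarrow> y \<in> int_lattice m \<Longrightarrow> x + y \<in> int_lattice m"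
  by (simp add: int_lattice_def)

lemma e_char_add: "e_char (x + y) = e_char x * e_char y"
  by (simp add: e_char_def distrib_left exp_add)

lemma e_char_0 [simp]: "e_char 0 = 1"
  by (simp add: e_char_def)

lemma cmod_e_char [simp]: "cmod (e_char x) = 1"
proof -
  have "2 * complex_of_real pi * \<i> * of_real x = \<i> * of_real (2 * pi * x)"
    by simp
  then show ?thesis
    unfolding e_char_def by (metis norm_exp_i_times)
qed

lemma cnj_e_char: "cnj (e_char x) = e_char (- x)"
  by (simp add: e_char_def exp_cnj)

lemma e_char_sum: "finite I \<Longrightarrow> e_char (\<Sum>i\<in>I. f i) = (\<Prod>i\<in>I. e_char (f i))"
  by (induction I rule: finite_induct) (simp_all add: e_char_add)

lemma e_char_of_int [simp]: "e_char (of_int k) = 1"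
  using exp_integer_2pi[of "of_int k"] by (simp add: e_char_def mult_ac)

lemma continuous_on_e_char [continuous_intros]:
  "continuous_on S f \<Longrightarrow> continuous_on S (\<lambda>x. e_char (f x))"
  unfolding e_char_def by (intro continuous_intros)

lemma borel_measurable_e_char [measurable]: "e_char \<in> borel_measurable borel"
  by (intro borel_measurable_continuous_onI continuous_intros)

text \<open>For \<open>k \<noteq> 0\<close> the antiderivative \<open>exp (c * x) / c\<close> takes
  equal values at 0 and 1, because \<open>exp c = 1\<close>.\<close>

lemma integral_e_char:
  "(LINT x|restrict_space lborel {0..<1}. e_char (of_int k * x)) = (if k = 0 then 1 else 0)"
proof -
  have "(LINT x|restrict_space lborel {0..<1}. e_char (of_int k * x))
      = (LINT x|lborel. indicator {0..<1} x *\<^sub>R e_char (of_int k * x))"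
    by (subst integral_restrict_space) auto
  \<comment> \<open>The two intervals differ by the null set \<open>{1}\<close>; the closed one is
    the form needed for the fundamental theorem of calculus.\<close>
  also have "\<dots> = (LINT x|lborel. indicator {0..1} x *\<^sub>R e_char (of_int k * x))"
  proof (rule integral_cong_AE)
    have "AE x in lborel. x \<noteq> (1::real)"
      by (rule AE_lborel_singleton)
    then show "AE x in lborel. indicator {0..<1} x *\<^sub>R e_char (of_int k * x)
        = indicator {0..1} x *\<^sub>R e_char (of_int k * x)"
      by eventually_elim (auto simp: indicator_def)
  qed measurable
  also have "\<dots> = (if k = 0 then 1 else 0)"
  proof (cases "k = 0")
    case False
    define c where "c = 2 * complex_of_real pi * \<i> * of_int k"
    have c: "c \<noteq> 0"
      using False by (simp add: c_def)
    have e: "e_char (of_int k * x) = exp (c * of_real x)" for x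
      by (simp add: e_char_def c_def mult_ac)
    have "(LINT x|lborel. indicator {0..1} x *\<^sub>R e_char (of_int k * x))
        = exp (c * of_real 1) / c - exp (c * of_real 0) / c"
      unfolding e
    proof (rule integral_FTC_atLeastAtMost)
      show "((\<lambda>x. exp (c * complex_of_real x) / c) has_vector_derivative exp (c * complex_of_real x))
          (at x within {0..1})" for x :: real
      proof -
        have "((\<lambda>z. exp (c * z) / c) has_field_derivative exp (c * complex_of_real x))
            (at (of_real x))"
          using c by (auto intro!: derivative_eq_intros)
        from has_vector_derivative_real_field[OF this] show ?thesis .
      qed
    qed (auto intro!: continuous_intros)
    also have "exp (c * of_real 1) = 1"
      using e[of 1] by simp
    finally show ?thesis
      using False by simp
  qed simp
  finally show ?thesis .
qed

interpretation torus: product_sigma_finite "\<lambda>_::nat. restrict_space lborel {0..<1::real}"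
  by (simp add: product_sigma_finite_def sigma_finite_measure_restrict_space lborel.sigma_finite_measure_axioms)

lemma finite_measure_torus: "finite_measure (torus_measure m)"
proof
  have "emeasure (torus_measure m) (space (torus_measure m))
      = (\<Prod>i<m. emeasure (restrict_space lborel {0..<1::real}) (space (restrict_space lborel {0..<1})))"
    unfolding torus_measure_def space_PiM by (rule torus.emeasure_PiM) (auto simp: sets_restrict_space_iff)
  also have "\<dots> = 1"
    by (simp add: space_restrict_space emeasure_restrict_space)
  finally show "emeasure (torus_measure m) (space (torus_measure m)) \<noteq> \<infinity>"
    by simp
qed

definition torus_char :: "nat \<Rightarrow> (nat \<Rightarrow> int) \<Rightarrow> (nat \<Rightarrow> real) \<Rightarrow> complex" where
  "torus_char m a t = e_char (\<Sum>i<m. of_int (a i) * t i)"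

lemma cmod_torus_char [simp]: "cmod (torus_char m a t) = 1"
  by (simp add: torus_char_def)

lemma torus_char_add: "torus_char m (a + b) t = torus_char m a t * torus_char m b t"
  by (simp add: torus_char_def e_char_add[symmetric] distrib_right sum.distrib)

lemma torus_char_mult_cnj:
  "torus_char m a t * cnj (torus_char m b t) = torus_char m (a - b) t"
  by (simp add: torus_char_def cnj_e_char e_char_add[symmetric] left_diff_distrib sum_subtractf)

lemma borel_measurable_torus_char [measurable]:
  "torus_char m a \<in> borel_measurable (torus_measure m)"
proof -
  have "(\<lambda>t. t i) \<in> borel_measurable (torus_measure m)" if "i < m" for i
  proof -
    have "(\<lambda>t. t i) \<in> torus_measure m \<rightarrow>\<^sub>M restrict_space lborel {0..<1}"
      unfolding torus_measure_def using that by (intro measurable_component_singleton) auto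
    then show ?thesis
      by (simp add: measurable_restrict_space2_iff)
  qed
  then have "(\<lambda>t. \<Sum>i<m. of_int (a i) * t i) \<in> borel_measurable (torus_measure m)"
    by (intro borel_measurable_sum borel_measurable_times) auto
  then show ?thesis
    unfolding torus_char_def by measurable
qed

lemma integrable_torus_bounded:
  fixes f :: "(nat \<Rightarrow> real) \<Rightarrow> 'b::{banach, second_countable_topology}"
  assumes "f \<in> borel_measurable (torus_measure m)" "\<And>t. norm (f t) \<le> B"
  shows "integrable (torus_measure m) f"
  by (rule finite_measure.integrable_const_bound[OF finite_measure_torus, of _ B]) (use assms in auto)

text \<open>Fubini factors the integral over the coordinates. A nonzero \<open>a\<close> in
  \<open>int_lattice m\<close> has a nonzero coordinate below \<open>m\<close>, and the factor of
  that coordinate vanishes.\<close>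

lemma integral_torus_char:
  assumes "a \<in> int_lattice m"
  shows "(LINT t|torus_measure m. torus_char m a t) = (if a = 0 then 1 else 0)"
proof -
  have "integrable (restrict_space lborel {0..<1}) (\<lambda>x. e_char (of_int (a i) * x))" for i
  proof (rule finite_measure.integrable_const_bound)
    show "finite_measure (restrict_space lborel {0..<1::real})"
      by (rule finite_measureI) (simp add: space_restrict_space emeasure_restrict_space)
    show "(\<lambda>x. e_char (of_int (a i) * x)) \<in> borel_measurable (restrict_space lborel {0..<1})"
      by (rule measurable_restrict_space1) measurable
  qed auto
  then have "(LINT t|torus_measure m. (\<Prod>i<m. e_char (of_int (a i) * t i)))
      = (\<Prod>i<m. LINT x|restrict_space lborel {0..<1}. e_char (of_int (a i) * x))"
    unfolding torus_measure_def by (intro torus.product_integral_prod) auto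
  also have "\<dots> = (\<Prod>i<m. if a i = 0 then 1 else 0)"
    by (simp only: integral_e_char)
  also have "\<dots> = (if a = 0 then 1 else 0)"
  proof (cases "a = 0")
    case False
    then obtain i where "a i \<noteq> 0"
      by (auto simp: fun_eq_iff)
    moreover from this have "i < m"
      using assms by (auto simp: int_lattice_def not_le[symmetric])
    ultimately show ?thesis
      using False by (auto simp: prod_zero_iff)
  qed simp
  finally show ?thesis
    by (simp add: torus_char_def e_char_sum)
qed

text \<open>Summing over an indexed family keeps multiplicities, so that the square of the sum over
  \<open>D\<close> is again such a sum, with index set \<open>D \<times> D\<close> and frequencies
  \<open>fst p + snd p\<close>.\<close>

definition trig_sum :: "nat \<Rightarrow> ('i \<Rightarrow> nat \<Rightarrow> int) \<Rightarrow> 'i set \<Rightarrow> (nat \<Rightarrow> real) \<Rightarrow> complex" where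
  "trig_sum m f I t = (\<Sum>i\<in>I. torus_char m (f i) t)"

lemma borel_measurable_trig_sum [measurable]:
  "trig_sum m f I \<in> borel_measurable (torus_measure m)"
  unfolding trig_sum_def by measurable

lemma cmod_trig_sum_le: "cmod (trig_sum m f I t) \<le> card I"
  unfolding trig_sum_def by (rule order_trans[OF norm_sum]) simp

text \<open>Orthogonality of characters: after expanding the product, only index pairs with equal
  frequencies survive integration.\<close>

lemma integral_trig_sum_mult_cnj:
  assumes "finite I" "finite J" "f ` I \<subseteq> int_lattice m" "g ` J \<subseteq> int_lattice m"
  shows "(LINT t|torus_measure m. trig_sum m f I t * cnj (trig_sum m g J t))
    = of_nat (card {p \<in> I \<times> J. f (fst p) = g (snd p)})"
proof -
  have "trig_sum m f I t * cnj (trig_sum m g J t)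
      = (\<Sum>p\<in>I \<times> J. torus_char m (f (fst p) - g (snd p)) t)" for t
    by (simp add: trig_sum_def sum_product sum.cartesian_product torus_char_mult_cnj case_prod_unfold)
  then have "(LINT t|torus_measure m. trig_sum m f I t * cnj (trig_sum m g J t))
      = (\<Sum>p\<in>I \<times> J. LINT t|torus_measure m. torus_char m (f (fst p) - g (snd p)) t)"
    by (simp add: Bochner_Integration.integral_sum integrable_torus_bounded[where B = 1])
  also have "\<dots> = (\<Sum>p\<in>I \<times> J. if f (fst p) = g (snd p) then 1 else 0)"
  proof (rule sum.cong)
    fix p assume "p \<in> I \<times> J"
    then have "f (fst p) \<in> int_lattice m" "g (snd p) \<in> int_lattice m"
      using assms by auto
    then have "f (fst p) - g (snd p) \<in> int_lattice m"
      by (auto simp: int_lattice_def)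
    then show "(LINT t|torus_measure m. torus_char m (f (fst p) - g (snd p)) t)
        = (if f (fst p) = g (snd p) then 1 else 0)"
      by (simp add: integral_torus_char)
  qed simp
  also have "\<dots> = of_nat (card {p \<in> I \<times> J. f (fst p) = g (snd p)})"
    using assms by (simp add: sum.If_cases Int_def)
  finally show ?thesis .
qed

lemma integral_cmod_trig_sum_squared:
  assumes "finite I" "f ` I \<subseteq> int_lattice m"
  shows "(LINT t|torus_measure m. (cmod (trig_sum m f I t))\<^sup>2)
    = card {p \<in> I \<times> I. f (fst p) = f (snd p)}"
proof -
  have "complex_of_real (LINT t|torus_measure m. (cmod (trig_sum m f I t))\<^sup>2)
      = (LINT t|torus_measure m. trig_sum m f I t * cnj (trig_sum m f I t))"
    by (simp add: integral_complex_of_real[symmetric] complex_norm_square del: of_real_power)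
  also have "\<dots> = of_real (card {p \<in> I \<times> I. f (fst p) = f (snd p)})"
    using assms by (simp add: integral_trig_sum_mult_cnj)
  finally show ?thesis
    using of_real_eq_iff by blast
qed

section \<open>Cauchy--Schwarz and the lower bound for additive energy\<close>

lemma Cauchy_Schwarz_integral:
  fixes f g :: "'a \<Rightarrow> real"
  assumes "integrable M (\<lambda>x. (f x)\<^sup>2)" "integrable M (\<lambda>x. (g x)\<^sup>2)" "integrable M (\<lambda>x. f x * g x)"
  shows "(LINT x|M. f x * g x)\<^sup>2 \<le> (LINT x|M. (f x)\<^sup>2) * (LINT x|M. (g x)\<^sup>2)"
proof -
  define F G H where "F = (LINT x|M. (f x)\<^sup>2)" "G = (LINT x|M. (g x)\<^sup>2)"
    "H = (LINT x|M. f x * g x)"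
  have quad: "0 \<le> F - 2 * c * H + c\<^sup>2 * G" for c
  proof -
    have "(LINT x|M. (f x - c * g x)\<^sup>2) = (LINT x|M. (f x)\<^sup>2 - (2 * c) * (f x * g x) + c\<^sup>2 * (g x)\<^sup>2)"
      by (intro Bochner_Integration.integral_cong) (auto simp: power2_eq_square algebra_simps)
    also have "\<dots> = F - 2 * c * H + c\<^sup>2 * G"
      using assms by (simp add: F_G_H_def)
    finally have "(LINT x|M. (f x - c * g x)\<^sup>2) = F - 2 * c * H + c\<^sup>2 * G" .
    moreover have "0 \<le> (LINT x|M. (f x - c * g x)\<^sup>2)"
      by simp
    ultimately show ?thesis
      by simp
  qed
  have "H\<^sup>2 \<le> F * G"
  proof (cases "G = 0")
    case True
    have "H = 0"
    proof (rule ccontr)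
      assume "H \<noteq> 0"
      \<comment> \<open>With \<open>G = 0\<close> the quadratic is linear in \<open>c\<close>; this
        value of \<open>c\<close> would make it equal to -1.\<close>
      then have "2 * ((F + 1) / (2 * H)) * H = F + 1"
        by simp
      then show False
        using quad[of "(F + 1) / (2 * H)"] True by simp
    qed
    then show ?thesis
      using True by simp
  next
    case False
    moreover have "G \<ge> 0"
      by (simp add: F_G_H_def)
    ultimately have "G > 0"
      by simp
    \<comment> \<open>\<open>c = H / G\<close> minimises the quadratic.\<close>
    have "F - 2 * (H / G) * H + (H / G)\<^sup>2 * G = F - H\<^sup>2 / G"
      using \<open>G > 0\<close> by (simp add: power2_eq_square divide_simps)
    then have "H\<^sup>2 / G \<le> F"
      using quad[of "H / G"] by simp
    then show ?thesis
      using \<open>G > 0\<close> by (simp add: pos_divide_le_eq)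
  qed
  then show ?thesis
    by (simp add: F_G_H_def)
qed

text \<open>Quadruples are encoded as pairs of pairs to match the count in
  \<open>integral_cmod_trig_sum_squared\<close> for the index set
  \<open>D \<times> D\<close>.\<close>

definition additive_energy :: "'a::ab_group_add set \<Rightarrow> nat" where
  "additive_energy D = card {p \<in> (D \<times> D) \<times> (D \<times> D).
     fst (fst p) + snd (fst p) = fst (snd p) + snd (snd p)}"

theorem additive_energy_lower_bound:
  assumes A: "finite A" "A \<subseteq> int_lattice m" and D: "D \<subseteq> A"
  shows "real (card D) ^ 4 \<le> (fourier_L1 m A)\<^sup>2 * card A * additive_energy D"
proof -
  define F G where "F = trig_sum m (\<lambda>a. a) A" "G = trig_sum m (\<lambda>a. a) D"
  have [measurable]: "F \<in> borel_measurable (torus_measure m)" "G \<in> borel_measurable (torus_measure m)"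
    by (simp_all add: F_G_def borel_measurable_trig_sum)
  have FB: "cmod (F t) \<le> card A" and GB: "cmod (G t) \<le> card D" for t
    by (simp_all add: F_G_def cmod_trig_sum_le)
  have fin: "finite D"
    using A D finite_subset by auto
  have bounded: "integrable (torus_measure m) (\<lambda>t. cmod (F t) ^ i * cmod (G t) ^ j)" for i j
    by (rule integrable_torus_bounded[where B = "real (card A) ^ i * real (card D) ^ j"])
      (auto simp: norm_mult norm_power intro!: mult_mono power_mono FB GB)
  have K: "fourier_L1 m A = (LINT t|torus_measure m. cmod (F t))"
    by (simp add: fourier_L1_def F_G_def trig_sum_def torus_char_def)
  have "{p \<in> A \<times> D. fst p = snd p} = (\<lambda>a. (a, a)) ` D"
    using D by auto
  then have cardD: "card {p \<in> A \<times> D. fst p = snd p} = card D"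
    by (simp add: card_image inj_on_def)
  have "real (card D) = cmod (LINT t|torus_measure m. F t * cnj (G t))"
    using A D fin by (simp add: F_G_def integral_trig_sum_mult_cnj cardD)
  also have "\<dots> \<le> (LINT t|torus_measure m. cmod (F t) * cmod (G t))"
    using integral_norm_bound[of "torus_measure m" "\<lambda>t. F t * cnj (G t)"] by (simp add: norm_mult)
  \<comment> \<open>Splitting \<open>cmod (F t)\<close> into two square roots makes the first factor
    in Cauchy--Schwarz exactly the Fourier norm of \<open>A\<close>.\<close>
  also have "\<dots> = (LINT t|torus_measure m. sqrt (cmod (F t)) * (sqrt (cmod (F t)) * cmod (G t)))"
    by (simp add: mult.assoc[symmetric])
  finally have "(real (card D))\<^sup>2 \<le> \<dots>\<^sup>2"
    by (intro power_mono) auto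
  also have "\<dots> \<le> (LINT t|torus_measure m. (sqrt (cmod (F t)))\<^sup>2)
      * (LINT t|torus_measure m. (sqrt (cmod (F t)) * cmod (G t))\<^sup>2)"
    using bounded[of 1 0] bounded[of 1 2] bounded[of 1 1]
    by (intro Cauchy_Schwarz_integral) (simp_all add: power_mult_distrib mult.assoc[symmetric])
  also have "\<dots> = fourier_L1 m A * (LINT t|torus_measure m. cmod (F t) * (cmod (G t))\<^sup>2)"
    by (simp add: K power_mult_distrib)
  finally have "((real (card D))\<^sup>2)\<^sup>2
      \<le> (fourier_L1 m A * (LINT t|torus_measure m. cmod (F t) * (cmod (G t))\<^sup>2))\<^sup>2"
    by (intro power_mono) auto
  also have "\<dots> = (fourier_L1 m A)\<^sup>2 * (LINT t|torus_measure m. cmod (F t) * (cmod (G t))\<^sup>2)\<^sup>2"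
    by (simp add: power_mult_distrib)
  \<comment> \<open>The second Cauchy--Schwarz separates \<open>cmod (F t)\<close> from
    \<open>(cmod (G t))\<^sup>2\<close>; the mean square of \<open>F\<close> is
    \<open>card A\<close> and the fourth moment of \<open>G\<close> is the energy of
    \<open>D\<close>.\<close>
  also have "\<dots> \<le> (fourier_L1 m A)\<^sup>2 * ((LINT t|torus_measure m. (cmod (F t))\<^sup>2)
      * (LINT t|torus_measure m. ((cmod (G t))\<^sup>2)\<^sup>2))"
    using bounded[of 2 0] bounded[of 0 4] bounded[of 1 2]
    by (intro mult_left_mono Cauchy_Schwarz_integral) (simp_all add: power_mult[symmetric])
  also have "(LINT t|torus_measure m. (cmod (F t))\<^sup>2) = card A"
  proof -
    have "{p \<in> A \<times> A. fst p = snd p} = (\<lambda>a. (a, a)) ` A"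
      by auto
    then show ?thesis
      using A by (simp add: F_G_def integral_cmod_trig_sum_squared card_image inj_on_def)
  qed
  also have "(LINT t|torus_measure m. ((cmod (G t))\<^sup>2)\<^sup>2) = additive_energy D"
  proof -
    have "(cmod (G t))\<^sup>2 = cmod (trig_sum m (\<lambda>p. fst p + snd p) (D \<times> D) t)" for t
      by (simp add: F_G_def trig_sum_def norm_power[symmetric] power2_eq_square sum_product
          sum.cartesian_product case_prod_unfold torus_char_add norm_mult[symmetric])
    moreover have "(\<lambda>p. fst p + snd p) ` (D \<times> D) \<subseteq> int_lattice m"
    proof -
      have "D \<subseteq> int_lattice m"
        using A D by blast
      then show ?thesis
        by (auto intro!: int_lattice_add)
    qed
    ultimately show ?thesis
      using fin by (simp add: integral_cmod_trig_sum_squared additive_energy_def)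
  qed
  finally show ?thesis
    by (simp add: power_mult[symmetric] mult.assoc)
qed

section \<open>Slices of spheres\<close>

definition real_coords :: "nat \<Rightarrow> (nat \<Rightarrow> real) set" where
  "real_coords d = {x. \<forall>i\<ge>d. x i = 0}"

definition dot :: "nat \<Rightarrow> (nat \<Rightarrow> real) \<Rightarrow> (nat \<Rightarrow> real) \<Rightarrow> real" where
  "dot d x y = (\<Sum>i<d. x i * y i)"

interpretation real_fun: vector_space "\<lambda>c (f :: nat \<Rightarrow> real) i. c * f i"
  by unfold_locales (auto simp: fun_eq_iff algebra_simps)

lemma sum_apply: "(\<Sum>i\<in>I. f i) x = (\<Sum>i\<in>I. f i x)"
  by (induction I rule: infinite_finite_induct) auto

lemma real_coords_add: "x \<in> real_coords d \<Longrightarrow> y \<in> real_coords d \<Longrightarrow> x + y \<in> real_coords d"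
  by (simp add: real_coords_def)

lemma real_coords_diff: "x \<in> real_coords d \<Longrightarrow> y \<in> real_coords d \<Longrightarrow> x - y \<in> real_coords d"
  by (simp add: real_coords_def)

lemma dot_commute: "dot d x y = dot d y x"
  by (simp add: dot_def mult.commute)

lemma dot_add_right: "dot d x (y + z) = dot d x y + dot d x z"
  by (simp add: dot_def distrib_left sum.distrib)

lemma dot_diff_right: "dot d x (y - z) = dot d x y - dot d x z"
  by (simp add: dot_def right_diff_distrib sum_subtractf)

lemma dot_add_left: "dot d (x + y) z = dot d x z + dot d y z"
  by (simp add: dot_commute[of d _ z] dot_add_right)

lemma dot_diff_left: "dot d (x - y) z = dot d x z - dot d y z"
  by (simp add: dot_commute[of d _ z] dot_diff_right)

lemma dot_scale_right: "dot d x (\<lambda>i. c * y i) = c * dot d x y"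
  by (simp add: dot_def sum_distrib_left mult_ac)

lemma dot_zero_right [simp]: "dot d x 0 = 0"
  by (simp add: dot_def)

lemma dot_self_eq_0:
  assumes "x \<in> real_coords d" "dot d x x = 0"
  shows "x = 0"
proof -
  have "\<forall>i<d. x i * x i = 0"
    using assms(2) by (simp add: dot_def sum_nonneg_eq_0_iff)
  then have "x i = 0" for i
    using assms(1) by (cases "i < d") (auto simp: real_coords_def)
  then show ?thesis
    by (simp add: fun_eq_iff)
qed

lemma dot_span_eq_0:
  assumes "z \<in> real_fun.span N" "\<And>n. n \<in> N \<Longrightarrow> dot d u n = 0"
  shows "dot d u z = 0"
  using assms(1)
proof (induction rule: real_fun.span_induct_alt)
  case base
  show ?case
    by (rule dot_zero_right)
next
  case (step c x y)
  then show ?case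
    by (simp only: dot_add_right dot_scale_right assms(2) mult_zero_right add_0)
qed

text \<open>The \<open>d\<close> unit vectors span \<open>real_coords d\<close>, so the exchange
  bound applies.\<close>

lemma independent_real_coords:
  assumes "real_fun.independent N" "N \<subseteq> real_coords d"
  shows "finite N \<and> card N \<le> d"
proof -
  define e :: "nat \<Rightarrow> nat \<Rightarrow> real" where "e = (\<lambda>i j. if i = j then 1 else 0)"
  have "x \<in> real_fun.span (e ` {..<d})" if "x \<in> real_coords d" for x
  proof -
    have "(\<Sum>i<d. (\<lambda>j. x i * e i j)) j = x j" for j
    proof -
      have "(\<Sum>i<d. (\<lambda>j. x i * e i j)) j = (\<Sum>i<d. if i = j then x i else 0)"
        by (simp add: sum_apply e_def if_distrib cong: if_cong)
      also have "\<dots> = x j"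
        using that by (auto simp: real_coords_def)
      finally show ?thesis .
    qed
    then have "x = (\<Sum>i<d. (\<lambda>j. x i * e i j))"
      by (simp add: fun_eq_iff)
    moreover have "\<dots> \<in> real_fun.span (e ` {..<d})"
      by (intro real_fun.span_sum real_fun.span_scale real_fun.span_base) auto
    ultimately show ?thesis
      by simp
  qed
  then have "N \<subseteq> real_fun.span (e ` {..<d})"
    using assms(2) by blast
  from real_fun.independent_span_bound[OF _ assms(1) this]
  have "finite N \<and> card N \<le> card (e ` {..<d})"
    by simp
  then show ?thesis
    using card_image_le[of "{..<d}" e] by simp
qed

text \<open>A nonzero \<open>u\<close> orthogonal to \<open>N\<close> is not in the span of
  \<open>N\<close>, since \<open>dot d u u \<noteq> 0\<close>; adjoining it would give
  \<open>d + 1\<close> independent vectors in dimension \<open>d\<close>.\<close>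

lemma orthogonal_to_basis_eq_0:
  assumes "real_fun.independent N" "N \<subseteq> real_coords d" "card N = d"
    and u: "u \<in> real_coords d" "\<And>n. n \<in> N \<Longrightarrow> dot d u n = 0"
  shows "u = 0"
proof (rule ccontr)
  assume "u \<noteq> 0"
  then have "u \<notin> real_fun.span N"
    using dot_span_eq_0[of u N d u] u(2) dot_self_eq_0[OF u(1)] by auto
  moreover from this have "u \<notin> N"
    using real_fun.span_base by blast
  moreover have "finite N"
    using independent_real_coords[OF assms(1,2)] by simp
  ultimately show False
    using independent_real_coords[of "insert u N" d] assms real_fun.independent_insertI[of u N]
    by auto
qed

text \<open>
  \<open>B\<close> is modelled on the intersection of a sphere with an affine subspace whose directions are
  orthogonal to \<open>N\<close>.
\<close>

definition slice_model ::
  "nat \<Rightarrow> real \<Rightarrow> (nat \<Rightarrow> real) set \<Rightarrow> ('a::ab_group_add \<Rightarrow> nat \<Rightarrow> real) \<Rightarrow> 'a set \<Rightarrow> bool" where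
  "slice_model d \<rho> N \<psi> B \<longleftrightarrow> inj_on \<psi> B \<and>
    (\<forall>x\<in>B. \<psi> x \<in> real_coords d \<and> dot d (\<psi> x) (\<psi> x) = \<rho>) \<and>
    (\<forall>x\<in>B. \<forall>y\<in>B. \<forall>n\<in>N. dot d (\<psi> x - \<psi> y) n = 0) \<and>
    (\<forall>a\<in>B. \<forall>b\<in>B. \<forall>c\<in>B. \<forall>e\<in>B. a + b = c + e \<longrightarrow> \<psi> a + \<psi> b = \<psi> c + \<psi> e)"

lemma slice_modelD:
  assumes "slice_model d \<rho> N \<psi> B"
  shows "x \<in> B \<Longrightarrow> y \<in> B \<Longrightarrow> \<psi> x = \<psi> y \<Longrightarrow> x = y"
    and "x \<in> B \<Longrightarrow> \<psi> x \<in> real_coords d"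
    and "x \<in> B \<Longrightarrow> dot d (\<psi> x) (\<psi> x) = \<rho>"
    and "x \<in> B \<Longrightarrow> y \<in> B \<Longrightarrow> n \<in> N \<Longrightarrow> dot d (\<psi> x - \<psi> y) n = 0"
    and "a \<in> B \<Longrightarrow> b \<in> B \<Longrightarrow> c \<in> B \<Longrightarrow> e \<in> B \<Longrightarrow> a + b = c + e \<Longrightarrow> \<psi> a + \<psi> b = \<psi> c + \<psi> e"
  using assms unfolding slice_model_def inj_on_def by blast+

text \<open>Subtracting \<open>\<bar>x\<bar>\<^sup>2 = \<rho>\<close> from \<open>\<bar>z - x\<bar>\<^sup>2 = \<rho>\<close> leaves the linear equation \<open>2 x \<cdot> z = \<bar>z\<bar>\<^sup>2\<close>.\<close>

lemma slice_model_reflect: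
  assumes B: "slice_model d \<rho> N \<psi> B" and ab: "a \<in> B" "b \<in> B"
  shows "slice_model d \<rho> (insert (\<psi> a + \<psi> b) N) \<psi> {c \<in> B. a + b - c \<in> B}"
proof -
  define z where "z = \<psi> a + \<psi> b"
  have z: "2 * dot d (\<psi> c) z = dot d z z" if c: "c \<in> B" "a + b - c \<in> B" for c
  proof -
    \<comment> \<open>This additive relation inside \<open>B\<close> is preserved by
      \<open>\<psi>\<close>, so \<open>a + b - c\<close> is sent to the reflection
      \<open>z - \<psi> c\<close>.\<close>
    have "a + b = c + (a + b - c)"
      by simp
    then have "z = \<psi> c + \<psi> (a + b - c)"
      unfolding z_def by (intro slice_modelD(5)[OF B] ab c)
    then have "\<psi> (a + b - c) = z - \<psi> c"
      by simp
    moreover have "dot d (\<psi> (a + b - c)) (\<psi> (a + b - c)) = dot d (\<psi> c) (\<psi> c)"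
      using slice_modelD(3)[OF B] c by simp
    ultimately have "dot d (z - \<psi> c) (z - \<psi> c) = dot d (\<psi> c) (\<psi> c)"
      by simp
    then show ?thesis
      by (simp add: dot_diff_left dot_diff_right dot_commute[of d z "\<psi> c"])
  qed
  have "dot d (\<psi> c - \<psi> c') z = 0"
    if "c \<in> B" "a + b - c \<in> B" "c' \<in> B" "a + b - c' \<in> B" for c c'
    using z[of c] z[of c'] that by (simp add: dot_diff_left)
  with slice_modelD(4)[OF B]
  have "dot d (\<psi> c - \<psi> c') n = 0"
    if "n \<in> insert z N" "c \<in> B" "a + b - c \<in> B" "c' \<in> B" "a + b - c' \<in> B" for n c c'
    using that by auto
  moreover have "inj_on \<psi> {c \<in> B. a + b - c \<in> B}"
    using B by (auto simp: slice_model_def intro: inj_on_subset)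
  ultimately show ?thesis
    unfolding z_def[symmetric] slice_model_def
    using slice_modelD(2,3)[OF B] by (auto intro: slice_modelD(5)[OF B])
qed

text \<open>A sum of two points can be normal to the whole slice only if it is twice the centre.\<close>

lemma slice_model_span_sum_unique:
  assumes B: "slice_model d \<rho> N \<psi> B" and "a \<in> B" "b \<in> B" "a' \<in> B" "b' \<in> B"
    and "\<psi> a + \<psi> b \<in> real_fun.span N" "\<psi> a' + \<psi> b' \<in> real_fun.span N"
  shows "\<psi> a + \<psi> b = \<psi> a' + \<psi> b'"
proof -
  define u where "u = \<psi> a + \<psi> b - (\<psi> a' + \<psi> b')"
  \<comment> \<open>As a sum of differences of model points \<open>u\<close> is orthogonal to
    \<open>N\<close>, and it also lies in the span of \<open>N\<close>; hence it is orthogonal to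
    itself.\<close>
  have "u = (\<psi> a - \<psi> a') + (\<psi> b - \<psi> b')"
    by (simp add: u_def)
  then have "dot d u n = 0" if "n \<in> N" for n
    using slice_modelD(4)[OF B] assms that by (simp add: dot_add_left)
  moreover have "u \<in> real_fun.span N"
    unfolding u_def by (intro real_fun.span_diff assms)
  ultimately have "dot d u u = 0"
    by (rule dot_span_eq_0[rotated])
  moreover have "u \<in> real_coords d"
    unfolding u_def by (intro real_coords_diff real_coords_add slice_modelD(2)[OF B] assms)
  ultimately have "u = 0"
    by (rule dot_self_eq_0[rotated])
  then show ?thesis
    by (simp add: u_def)
qed

text \<open>The slice lies on a line. For distinct \<open>a\<close> and \<open>b\<close>, equal
  norms make \<open>\<psi> a - \<psi> b\<close> orthogonal to \<open>\<psi> a + \<psi> b\<close>;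
  were this sum outside the span of \<open>N\<close>, it would complete \<open>N\<close> to a basis
  and force \<open>\<psi> a = \<psi> b\<close>. So all sums of two distinct points lie in the span
  and coincide, which excludes a third point.\<close>

lemma slice_model_line_card_le_2:
  assumes B: "slice_model d \<rho> N \<psi> B"
    and N: "real_fun.independent N" "N \<subseteq> real_coords d" "card N + 1 = d"
  shows "card B \<le> 2"
proof -
  have span: "\<psi> a + \<psi> b \<in> real_fun.span N" if ab: "a \<in> B" "b \<in> B" "a \<noteq> b" for a b
  proof (rule ccontr)
    assume z: "\<psi> a + \<psi> b \<notin> real_fun.span N"
    have "\<psi> a - \<psi> b = 0"
    proof (rule orthogonal_to_basis_eq_0)
      show "real_fun.independent (insert (\<psi> a + \<psi> b) N)"
        by (rule real_fun.independent_insertI[OF z N(1)])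
      show "insert (\<psi> a + \<psi> b) N \<subseteq> real_coords d"
        using N(2) slice_modelD(2)[OF B] ab by (simp add: real_coords_add)
      show "card (insert (\<psi> a + \<psi> b) N) = d"
        using N(3) z independent_real_coords[OF N(1,2)] real_fun.span_superset[of N]
        by (subst card_insert_disjoint) auto
      show "\<psi> a - \<psi> b \<in> real_coords d"
        using slice_modelD(2)[OF B] ab by (simp add: real_coords_diff)
      show "dot d (\<psi> a - \<psi> b) n = 0" if "n \<in> insert (\<psi> a + \<psi> b) N" for n
        using that
      proof
        assume "n = \<psi> a + \<psi> b"
        then show ?thesis
          using slice_modelD(3)[OF B ab(1)] slice_modelD(3)[OF B ab(2)]
          by (simp add: dot_add_right dot_diff_left dot_commute[of d "\<psi> b" "\<psi> a"])
      qed (rule slice_modelD(4)[OF B ab(1,2)])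
    qed
    then show False
      using slice_modelD(1)[OF B ab(1,2)] ab(3) by simp
  qed
  show ?thesis
  proof (rule ccontr)
    assume "\<not> card B \<le> 2"
    then have "3 \<le> card B"
      by simp
    then obtain T where "T \<subseteq> B" "card T = 3"
      by (rule obtain_subset_with_card_n)
    then obtain a b c where "T = {a, b, c}" "a \<noteq> b" "a \<noteq> c" "b \<noteq> c"
      unfolding card_3_iff by blast
    with \<open>T \<subseteq> B\<close> have abc: "a \<in> B" "b \<in> B" "c \<in> B" "a \<noteq> b" "a \<noteq> c" "b \<noteq> c"
      by simp_all
    then have "\<psi> a + \<psi> b = \<psi> a + \<psi> c"
      by (intro slice_model_span_sum_unique[OF B] span)
    then show False
      using slice_modelD(1)[OF B abc(2,3)] abc by simp
  qed
qed

section \<open>Upper bound for the energy and induction on the dimension of the slice\<close>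

lemma additive_energy_upper_bound:
  fixes D :: "'a::ab_group_add set"
    and M :: real
  assumes D: "finite D" and Q: "Q \<subseteq> D \<times> D" "card Q \<le> card D"
    and M: "0 \<le> M" "\<And>p. p \<in> D \<times> D - Q \<Longrightarrow> real (card {c \<in> D. fst p + snd p - c \<in> D}) \<le> M"
  shows "real (additive_energy D) \<le> (card D)\<^sup>2 * (M + 1)"
proof -
  define r where "r = (\<lambda>p::'a \<times> 'a. {q \<in> D \<times> D. fst p + snd p = fst q + snd q})"
  \<comment> \<open>A representation of a given sum is determined by its first summand.\<close>
  have r: "card (r p) \<le> card {c \<in> D. fst p + snd p - c \<in> D}" for p
  proof (rule card_inj_on_le[where f = fst])
    show "inj_on fst (r p)"
      by (auto simp: inj_on_def r_def)
    show "fst ` r p \<subseteq> {c \<in> D. fst p + snd p - c \<in> D}"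
      by (auto simp: r_def)
  qed (use D in auto)
  \<comment> \<open>The exceptional pairs in \<open>Q\<close> get only the trivial bound
    \<open>card D\<close>.\<close>
  have rM: "real (card (r p)) \<le> M + (if p \<in> Q then card D else 0)" if "p \<in> D \<times> D" for p
  proof (cases "p \<in> Q")
    case True
    have "card {c \<in> D. fst p + snd p - c \<in> D} \<le> card D"
      using D by (intro card_mono) auto
    then show ?thesis
      using r[of p] M(1) True by simp
  next
    case False
    then show ?thesis
      using r[of p] M(2)[of p] that by simp
  qed
  have "{p \<in> (D \<times> D) \<times> (D \<times> D). fst (fst p) + snd (fst p) = fst (snd p) + snd (snd p)}
      = Sigma (D \<times> D) r"
    by (auto simp: r_def)
  then have "real (additive_energy D) = (\<Sum>p\<in>D \<times> D. real (card (r p)))"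
    using D by (simp add: additive_energy_def r_def)
  also have "\<dots> \<le> (\<Sum>p\<in>D \<times> D. M + (if p \<in> Q then card D else 0))"
    by (intro sum_mono rM)
  also have "\<dots> = (card D)\<^sup>2 * M + card Q * card D"
  proof -
    have "(\<Sum>p\<in>D \<times> D. real (if p \<in> Q then card D else 0)) = (\<Sum>p\<in>D \<times> D. if p \<in> Q then real (card D) else 0)"
      by (intro sum.cong) auto
    then show ?thesis
      using D Q by (simp add: sum.distrib sum.If_cases card_cartesian_product power2_eq_square
          Collect_mem_eq Int_absorb1)
  qed
  \<comment> \<open>There are at most \<open>card D\<close> exceptional pairs, so together they cost
    at most \<open>(card D)\<^sup>2\<close>: this is the \<open>+ 1\<close> in the claim.\<close>
  also have "\<dots> \<le> (card D)\<^sup>2 * M + card D * card D"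
    using Q by (simp add: mult_right_mono)
  finally show ?thesis
    by (simp add: power2_eq_square distrib_left)
qed

text \<open>The lower bound for the energy, taken with \<open>D = A\<close>, is compared with the
  trivial bound by \<open>card A\<close> cubed: three entries of an additive quadruple determine the
  fourth.\<close>

lemma fourier_L1_squared_ge_1:
  assumes A: "finite A" "A \<noteq> {}" "A \<subseteq> int_lattice m"
  shows "1 \<le> (fourier_L1 m A)\<^sup>2"
proof -
  have "{p \<in> (A \<times> A) \<times> (A \<times> A). fst (fst p) + snd (fst p) = fst (snd p) + snd (snd p)}
    \<subseteq> (\<lambda>((a, b), c). ((a, b), (c, a + b - c))) ` ((A \<times> A) \<times> A)"
    by (auto simp: image_iff algebra_simps)
  then have "additive_energy A \<le> card ((A \<times> A) \<times> A)"
    unfolding additive_energy_def using A by (intro surj_card_le) auto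
  then have E: "real (additive_energy A) \<le> (card A)\<^sup>2 * real (card A)"
    by (simp add: card_cartesian_product power2_eq_square flip: of_nat_mult)
  have n: "real (card A) > 0"
    using A by (simp add: card_gt_0_iff)
  have "real (card A) ^ 4 \<le> (fourier_L1 m A)\<^sup>2 * card A * additive_energy A"
    using additive_energy_lower_bound[of A m A] A by simp
  also have "\<dots> \<le> (fourier_L1 m A)\<^sup>2 * card A * ((card A)\<^sup>2 * real (card A))"
    using E by (intro mult_left_mono) auto
  finally have "1 * real (card A) ^ 4 \<le> (fourier_L1 m A)\<^sup>2 * real (card A) ^ 4"
    by (simp add: power2_eq_square power4_eq_xxxx mult_ac)
  then show ?thesis
    using n by (subst (asm) mult_le_cancel_right) auto
qed

text \<open>The affine subspace has dimension \<open>Suc k\<close>, so the induction starts from a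
  line at \<open>k = 0\<close>. The constant \<open>2 * (fourier_L1 m A)\<^sup>2\<close> reproduces
  itself in the induction step.\<close>

theorem slice_model_card_le:
  assumes A: "finite A" "A \<noteq> {}" "A \<subseteq> int_lattice m"
    and "real_fun.independent N" "N \<subseteq> real_coords d" "card N + Suc k = d"
    and "B \<subseteq> A" "slice_model d \<rho> N \<psi> B"
  shows "real (card B) \<le> 2 * (fourier_L1 m A)\<^sup>2 * real (card A) powr (1 - 1 / 2 ^ k)"
  using assms(4-)
proof (induction k arbitrary: N B)
  case 0
  have n: "real (card A) > 0"
    using A by (simp add: card_gt_0_iff)
  have "card B \<le> 2"
    using 0 by (intro slice_model_line_card_le_2) auto
  \<comment> \<open>The exponent is 0 here, so the bound is twice the squared norm, hence at least
    2.\<close>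
  then show ?case
    using fourier_L1_squared_ge_1[OF A] n by simp
next
  case (Suc k)
  define n L where "n = real (card A)" "L = (fourier_L1 m A)\<^sup>2"
  define M where "M = 2 * L * n powr (1 - 1 / 2 ^ k)"
  define x where "x = real (card B)"
  \<comment> \<open>The exceptional pairs: their sum yields no new independent normal, so reflecting
    need not lower the dimension.\<close>
  define Q where "Q = {p \<in> B \<times> B. \<psi> (fst p) + \<psi> (snd p) \<in> real_fun.span N}"
  have n: "n \<ge> 1"
    using A by (simp add: n_L_def Suc_le_eq card_gt_0_iff)
  have L: "L \<ge> 1"
    using fourier_L1_squared_ge_1[OF A] by (simp add: n_L_def)
  have "1 * 1 \<le> L * n powr (1 - 1 / 2 ^ k)"
    using n L by (intro mult_mono ge_one_powr_ge_zero) auto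
  then have M1: "M \<ge> 1"
    by (simp add: M_def)
  have fin: "finite B"
    using Suc.prems A finite_subset by blast
  have "real (additive_energy B) \<le> (card B)\<^sup>2 * (M + 1)"
  proof (rule additive_energy_upper_bound[OF fin])
    show "Q \<subseteq> B \<times> B"
      by (auto simp: Q_def)
    show "card Q \<le> card B"
    \<comment> \<open>All sums lying in the span of \<open>N\<close> coincide, so the first entry of
      a pair in \<open>Q\<close> determines the second.\<close>
    proof (rule card_inj_on_le[where f = fst])
      show "inj_on fst Q"
      proof (rule inj_onI)
        fix p q assume pq: "p \<in> Q" "q \<in> Q" "fst p = fst q"
        then have "\<psi> (fst p) + \<psi> (snd p) = \<psi> (fst q) + \<psi> (snd q)"
          by (intro slice_model_span_sum_unique[OF Suc.prems(5)]) (auto simp: Q_def)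
        then have "\<psi> (snd p) = \<psi> (snd q)"
          using pq by simp
        then have "snd p = snd q"
          using pq by (intro slice_modelD(1)[OF Suc.prems(5)]) (auto simp: Q_def)
        then show "p = q"
          using pq by (simp add: prod_eq_iff)
      qed
    qed (use fin in \<open>auto simp: Q_def\<close>)
    show "0 \<le> M"
      using M1 by simp
    fix p assume p: "p \<in> B \<times> B - Q"
    define z where "z = \<psi> (fst p) + \<psi> (snd p)"
    have z: "z \<notin> real_fun.span N"
      using p by (auto simp: Q_def z_def)
    \<comment> \<open>Outside \<open>Q\<close> the sum \<open>z\<close> is a new independent normal,
      so the reflected set has dimension one less and the induction hypothesis applies.\<close>
    show "real (card {c \<in> B. fst p + snd p - c \<in> B}) \<le> M"
      unfolding M_def n_L_def
    proof (rule Suc.IH)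
      show "real_fun.independent (insert z N)"
        by (rule real_fun.independent_insertI[OF z Suc.prems(1)])
      show "insert z N \<subseteq> real_coords d"
        using Suc.prems(2) slice_modelD(2)[OF Suc.prems(5)] p by (auto simp: z_def intro: real_coords_add)
      show "card (insert z N) + Suc k = d"
        using Suc.prems(3) z independent_real_coords[OF Suc.prems(1,2)]
          real_fun.span_superset[of N]
        by (subst card_insert_disjoint) auto
      show "{c \<in> B. fst p + snd p - c \<in> B} \<subseteq> A"
        using Suc.prems by auto
      show "slice_model d \<rho> (insert z N) \<psi> {c \<in> B. fst p + snd p - c \<in> B}"
        unfolding z_def using p by (intro slice_model_reflect Suc.prems) auto
    qed
  qed
  \<comment> \<open>\<open>M \<ge> 1\<close> absorbs the summand 1 at the cost of a factor
    2.\<close>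
  then have E: "real (additive_energy B) \<le> x\<^sup>2 * (2 * M)"
    using M1 mult_left_mono[of "M + 1" "2 * M" "x\<^sup>2"] by (simp add: x_def)
  have "x ^ 4 \<le> L * n * additive_energy B"
    using additive_energy_lower_bound[of A m B] A Suc.prems by (simp add: x_def n_L_def)
  also have "\<dots> \<le> L * n * (x\<^sup>2 * (2 * M))"
    using E L n by (intro mult_left_mono) auto
  finally have x4: "x\<^sup>2 * x\<^sup>2 \<le> (2 * L * n * M) * x\<^sup>2"
    by (simp add: power2_eq_square power4_eq_xxxx mult_ac)
  have "x\<^sup>2 \<le> 2 * L * n * M"
  proof (cases "x = 0")
    case True
    then show ?thesis
      using L n M1 by simp
  next
    case False
    then show ?thesis
      using x4 by (subst (asm) mult_le_cancel_right) auto
  qed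
  \<comment> \<open>Inserting \<open>M\<close> gives the constant \<open>4 * L\<^sup>2\<close> and
    the exponent \<open>2 - 1 / 2 ^ k\<close>, which is twice
    \<open>1 - 1 / 2 ^ Suc k\<close>.\<close>
  also have "\<dots> = (2 * L * n powr (1 - 1 / 2 ^ Suc k))\<^sup>2"
  proof -
    have "n * n powr (1 - 1 / 2 ^ k) = n powr (1 + (1 - 1 / 2 ^ k))"
      using n by (subst powr_add) simp
    also have "1 + (1 - 1 / 2 ^ k) = (1 - 1 / 2 ^ Suc k) + (1 - 1 / 2 ^ Suc k :: real)"
      by simp
    also have "n powr \<dots> = (n powr (1 - 1 / 2 ^ Suc k))\<^sup>2"
      by (simp only: powr_add power2_eq_square)
    finally show ?thesis
      by (simp add: M_def power_mult_distrib power2_eq_square mult_ac)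
  qed
  finally have "x \<le> 2 * L * n powr (1 - 1 / 2 ^ Suc k)"
    by (rule power2_le_imp_le) (use L in auto)
  then show ?case
    by (simp add: x_def n_L_def)
qed

section \<open>Freiman models\<close>

text \<open>Both pairs are padded with \<open>h - 2\<close> copies of \<open>a\<close>; the padding
  cancels before and after applying \<open>\<phi>\<close>.\<close>

lemma freiman_hom_2:
  assumes \<phi>: "freiman_hom h \<phi> D S" "h \<ge> 2"
    and D: "a \<in> D" "b \<in> D" "c \<in> D" "e \<in> D" and eq: "a + b = c + e"
  shows "\<phi> a + \<phi> b = \<phi> c + \<phi> e"
proof -
  define pad where "pad = (\<lambda>(u::'a) v i::nat. if i = 0 then u else if i = 1 then v else a)"
  \<comment> \<open>Stated for arbitrary \<open>f\<close> so as to serve both the identity and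
    \<open>\<phi>\<close>.\<close>
  have sum: "(\<Sum>i<h. f (pad u v i)) = f u + f v + (\<Sum>i = 2..<h. f a)"
    for u v and f :: "'a \<Rightarrow> 'c::ab_group_add"
  proof -
    have "{..<h} = insert 0 (insert 1 {2..<h})"
      using \<phi>(2) by auto
    then have "(\<Sum>i<h. f (pad u v i)) = f u + f v + (\<Sum>i = 2..<h. f (pad u v i))"
      by (simp add: pad_def add.assoc)
    also have "(\<Sum>i = 2..<h. f (pad u v i)) = (\<Sum>i = 2..<h. f a)"
      by (intro sum.cong) (auto simp: pad_def)
    finally show ?thesis .
  qed
  have "\<forall>i<h. pad a b i \<in> D \<and> pad c e i \<in> D"
    using D by (auto simp: pad_def)
  moreover have "(\<Sum>i<h. pad a b i) = (\<Sum>i<h. pad c e i)"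
    using eq sum[of "\<lambda>u. u" a b] sum[of "\<lambda>u. u" c e] by simp
  ultimately have "(\<Sum>i<h. \<phi> (pad a b i)) = (\<Sum>i<h. \<phi> (pad c e i))"
    using \<phi>(1) unfolding freiman_hom_def by blast
  then show ?thesis
    by (simp add: sum)
qed

text \<open>The whole sphere is the slice without normals, with \<open>\<rho>\<close> the squared
  radius; \<open>\<psi>\<close> is \<open>\<phi>\<close> with its coordinates read as reals.\<close>

lemma spherical_freiman_model_slice:
  assumes "spherical_freiman_model d D"
  obtains \<rho> and \<psi> :: "(nat \<Rightarrow> int) \<Rightarrow> nat \<Rightarrow> real" where "slice_model d \<rho> {} \<psi> D"
proof -
  obtain h R S \<phi> where h: "h \<ge> 2" and S: "S \<subseteq> lattice_sphere d R" and \<phi>: "freiman_iso h \<phi> D S"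
    using assms by (auto simp: spherical_freiman_model_def)
  have bij: "bij_betw \<phi> D S" and hom: "freiman_hom h \<phi> D S"
    using \<phi> by (auto simp: freiman_iso_def)
  define \<psi> where "\<psi> = (\<lambda>x i. real_of_int (\<phi> x i))"
  have "slice_model d ((real R)\<^sup>2) {} \<psi> D"
    unfolding slice_model_def
  proof (intro conjI ballI impI)
    show "inj_on \<psi> D"
    proof (rule inj_onI)
      fix x y assume "x \<in> D" "y \<in> D" "\<psi> x = \<psi> y"
      then have "\<phi> x = \<phi> y"
        by (simp add: \<psi>_def fun_eq_iff)
      then show "x = y"
        using bij \<open>x \<in> D\<close> \<open>y \<in> D\<close> by (auto simp: bij_betw_def dest: inj_onD)
    qed
  next
    fix x assume "x \<in> D"
    then have x: "\<phi> x \<in> lattice_sphere d R"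
      using bij S by (auto simp: bij_betw_def)
    then show "\<psi> x \<in> real_coords d"
      by (simp add: \<psi>_def real_coords_def lattice_sphere_def int_lattice_def)
    have "real_of_int (\<Sum>i<d. (\<phi> x i)\<^sup>2) = real_of_int ((int R)\<^sup>2)"
      using x by (simp add: lattice_sphere_def)
    then show "dot d (\<psi> x) (\<psi> x) = (real R)\<^sup>2"
      by (simp add: \<psi>_def dot_def power2_eq_square)
  next
    fix a b c e assume "a \<in> D" "b \<in> D" "c \<in> D" "e \<in> D" "a + b = c + e"
    then have "\<phi> a + \<phi> b = \<phi> c + \<phi> e"
      by (rule freiman_hom_2[OF hom h])
    then have "\<phi> a i + \<phi> b i = \<phi> c i + \<phi> e i" for i
      by (metis plus_fun_apply)
    then have "real_of_int (\<phi> a i) + real_of_int (\<phi> b i) = real_of_int (\<phi> c i) + real_of_int (\<phi> e i)" for i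
      by (metis of_int_add)
    then show "\<psi> a + \<psi> b = \<psi> c + \<psi> e"
      by (simp add: \<psi>_def fun_eq_iff)
  qed auto
  then show ?thesis
    by (rule that)
qed

theorem spherical_freiman_model_card_le:
  assumes "finite A" "A \<noteq> {}" "A \<subseteq> int_lattice m" "d \<ge> 1"
    and "D \<subseteq> A" "spherical_freiman_model d D"
  shows "real (card D) \<le> 2 * (fourier_L1 m A)\<^sup>2 * real (card A) powr (1 - 1 / 2 ^ (d - 1))"
proof -
  obtain \<rho> and \<psi> :: "(nat \<Rightarrow> int) \<Rightarrow> nat \<Rightarrow> real" where "slice_model d \<rho> {} \<psi> D"
    using assms(6) by (rule spherical_freiman_model_slice)
  then show ?thesis
    using assms by (intro slice_model_card_le[where N = "{}"]) (auto simp: real_fun.dependent_def)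
qed

section \<open>From the explicit bound to the asymptotic exponent\<close>

theorem corollary7:
  fixes d :: nat
    and m :: "nat \<Rightarrow> nat"
    and A D :: "nat \<Rightarrow> (nat \<Rightarrow> int) set"
  assumes "d \<ge> 2"
    and "\<And>n. n \<ge> 1 \<Longrightarrow> finite (A n) \<and> A n \<noteq> {} \<and> A n \<subseteq> int_lattice (m n)"
    and "filterlim (\<lambda>n. card (A n)) at_top sequentially"
    and "\<exists>\<epsilon>::nat \<Rightarrow> real. \<epsilon> \<in> o(\<lambda>_. 1) \<and>
           (\<forall>\<^sub>F n in sequentially. fourier_L1 (m n) (A n) = real (card (A n)) powr \<epsilon> n)"
    and "\<And>n. n \<ge> 1 \<Longrightarrow> D n \<subseteq> A n \<and> spherical_freiman_model d (D n)"
  shows "\<exists>\<delta>::nat \<Rightarrow> real. \<delta> \<in> o(\<lambda>_. 1) \<and>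
           (\<forall>\<^sub>F n in sequentially.
              real (card (D n)) \<le> real (card (A n)) powr (1 - 1 / 2 ^ (d - 1) + \<delta> n))"
proof -
  obtain \<epsilon> :: "nat \<Rightarrow> real" where \<epsilon>: "\<epsilon> \<in> o(\<lambda>_. 1)"
    and K: "\<forall>\<^sub>F n in sequentially. fourier_L1 (m n) (A n) = real (card (A n)) powr \<epsilon> n"
    using assms(4) by blast
  \<comment> \<open>The squared norm contributes \<open>2 * \<epsilon> n\<close> to the exponent;
    the constant 2 is the power of \<open>card (A n)\<close> with exponent
    \<open>ln 2 / ln (card (A n))\<close>.\<close>
  define \<delta> where "\<delta> = (\<lambda>n. 2 * \<epsilon> n + ln 2 / ln (real (card (A n))))"
  have card_top: "filterlim (\<lambda>n. real (card (A n))) at_top sequentially"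
    by (rule filterlim_compose[OF filterlim_real_sequentially assms(3)])
  have "(\<lambda>n. ln 2 / ln (real (card (A n)))) \<longlonglongrightarrow> 0"
    by (intro tendsto_divide_0[OF tendsto_const] filterlim_at_top_imp_at_infinity
        filterlim_compose[OF ln_at_top card_top])
  moreover have "(\<lambda>n. 2 * \<epsilon> n) \<longlonglongrightarrow> 0"
    using smalloD_tendsto[OF \<epsilon>] by (auto intro: tendsto_mult_right_zero)
  ultimately have "\<delta> \<longlonglongrightarrow> 0"
    unfolding \<delta>_def by (rule tendsto_add_zero[rotated])
  then have "\<delta> \<in> o(\<lambda>_. 1)"
    by (intro smalloI_tendsto) auto
  moreover have "\<forall>\<^sub>F n in sequentially.
      real (card (D n)) \<le> real (card (A n)) powr (1 - 1 / 2 ^ (d - 1) + \<delta> n)"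
    \<comment> \<open>Eventually \<open>card (A n) > 1\<close>, so its logarithm is positive and the
      constant 2 can be written as such a power.\<close>
    using K eventually_ge_at_top[of 1] filterlim_at_top_dense[THEN iffD1, OF card_top, rule_format, of 1]
  proof eventually_elim
    case (elim n)
    define N where "N = real (card (A n))"
    have N: "N > 1"
      using elim(3) by (simp add: N_def)
    have "real (card (D n)) \<le> 2 * (fourier_L1 (m n) (A n))\<^sup>2 * N powr (1 - 1 / 2 ^ (d - 1))"
      unfolding N_def using assms(1) assms(2)[OF elim(2)] assms(5)[OF elim(2)]
      by (intro spherical_freiman_model_card_le) auto
    also have "\<dots> = N powr (ln 2 / ln N) * (N powr \<epsilon> n * N powr \<epsilon> n) * N powr (1 - 1 / 2 ^ (d - 1))"
      using N elim(1) by (simp add: N_def powr_def power2_eq_square)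
    also have "\<dots> = N powr (1 - 1 / 2 ^ (d - 1) + \<delta> n)"
      by (simp add: \<delta>_def N_def powr_add[symmetric] algebra_simps)
    finally show ?case
      by (simp add: N_def)
  qed
  ultimately show ?thesis
    by blast
qed

end
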